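(* Let $q$ be prime and let $a$ be an integer with $\gcd(a,q)=1$. Let $\mathcal R$ be any finite set of positive integers $r$ with $\gcd(r,q)=1$ and let $\mathcal S$ be any set of integers $s$ with $1\le s<q$. Then $$\left|\#\left\{(r,s_1,s_2)\in\mathcal R\times\mathcal S\times\mathcal S:\ r(s_1+s_2)\equiv a\pmod q\right\}-\frac1q|\mathcal R||\mathcal S|^2\right|\le|\mathcal S|\max_{h\not\equiv0\,(\mathrm{mod}\ q)}\left|\sum_{r\in\mathcal R}\mathbf e_q(h\overline r)\right|,$$ where the maximum is over integers $h$ not divisible by $q$.
   Context: $\mathbf e_q(z)=\exp(2\pi i z/q)$, and $\overline r$ denotes the multiplicative inverse of $r$ modulo $q$. *)

theory Defs
  imports Complex_Main "HOL-Number_Theory.Number_Theory" "HOL-Number_Theory.Modular_Inverse"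
begin

definition e_mod :: "int \<Rightarrow> complex \<Rightarrow> complex" where
  "e_mod q z = exp (2 * of_real pi * \<i> * z / of_int q)"

lemma e_mod_periodic:
  assumes "q \<noteq> 0" and "[m = n] (mod q)"
  shows "e_mod q (of_int m) = e_mod q (of_int n)"
proof -
  from assms(2) obtain k where k: "n = m + q * k"
    by (auto simp: cong_iff_lin)
  have "2 * of_real pi * \<i> * of_int n / of_int q =
        2 * of_real pi * \<i> * of_int m / of_int q + \<i> * of_real (2 * pi * of_int k)"
    using assms(1) by (simp add: k field_simps)
  moreover have "exp (\<i> * of_real (2 * pi * of_int k)) = 1"
    using cis_multiple_2pi[of "of_int k"] by (simp add: cis_conv_exp)
  ultimately show ?thesis
    unfolding e_mod_def by (simp add: exp_add)
qed

text \<open>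
  The index set \<open>{h. \<not> q dvd h}\<close> is infinite, but the sums depend only on \<open>h mod q\<close>.
  Hence the set of their absolute values is finite and nonempty, and \<^const>\<open>Max\<close> of it
  is a genuine maximum.
\<close>

lemma finite_norm_inverse_sums:
  fixes q :: int
  assumes "q > 0"
  shows "finite ((\<lambda>h. norm (\<Sum>r\<in>R. e_mod q (of_int (h * modular_inverse q r)))) ` {h. \<not> q dvd h})"
    (is "finite (?f ` _)")
proof (rule finite_subset)
  show "?f ` {h. \<not> q dvd h} \<subseteq> ?f ` {0..<q}"
  proof (rule image_subsetI)
    fix h
    have "e_mod q (of_int (h * modular_inverse q r)) =
          e_mod q (of_int (h mod q * modular_inverse q r))" for r
      using assms by (intro e_mod_periodic cong_mult cong_refl) (auto simp: cong_def)
    then have "?f h = ?f (h mod q)"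
      by presburger
    then show "?f h \<in> ?f ` {0..<q}"
      using assms by (intro image_eqI[of _ _ "h mod q"]) auto
  qed
qed simp

lemma norm_inverse_sums_nonempty:
  fixes q :: int
  assumes "prime q"
  shows "(\<lambda>h. norm (\<Sum>r\<in>R. e_mod q (of_int (h * modular_inverse q r)))) ` {h. \<not> q dvd h} \<noteq> {}"
  using assms not_prime_unit by blast

end

theory Submission
  imports Defs
begin

text \<open>
  For \<open>r\<close> prime to \<open>q\<close> the congruence \<open>r (s\<^sub>1 + s\<^sub>2) \<equiv> a\<close> says that
  \<open>s\<^sub>1 + s\<^sub>2 \<equiv> a r'\<close>, with \<open>r'\<close> the inverse of \<open>r\<close>. Averaging the additive characters
  \<open>h \<mapsto> e\<^sub>q (h n)\<close> over a full period detects \<open>q dvd n\<close> (\<open>sum_additive_char\<close>), so the number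
  of solutions is
  \<open>(1/q) \<Sum>h. F(h)\<^sup>2 T(- h a)\<close>, with \<open>h\<close> running over \<open>{0..<q}\<close>,
  where \<open>F(h)\<close> is the sum of \<open>e\<^sub>q (h s)\<close> over \<open>S\<close> and \<open>T(h)\<close> is the sum of \<open>e\<^sub>q (h r')\<close> over
  \<open>R\<close> (\<open>card_solutions_eq_exponential_sum\<close>).

  The term \<open>h = 0\<close> is exactly the main term \<open>|R| |S|\<^sup>2 / q\<close>. For the other \<open>h\<close> the integer
  \<open>- h a\<close> is again not divisible by \<open>q\<close>, because \<open>a\<close> is prime to \<open>q\<close>, and so \<open>|T(- h a)|\<close> is
  at most the maximum \<open>M\<close> on the right-hand side. What remains is \<open>M / q\<close> times the sum of
  \<open>|F(h)|\<^sup>2\<close>. As \<open>F\<close> enters through its square, Parseval's identity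
  (\<open>sum_norm_square_exponential_sum\<close>) evaluates the sum over all \<open>h\<close> as \<open>q |S|\<close>.
\<close>

text \<open>
  The restriction of \<^const>\<open>e_mod\<close> to integer arguments is a constant of its own so that
  the argument stays an integer under simplification, where divisibility by \<open>q\<close> makes sense.
\<close>

definition additive_char :: "int \<Rightarrow> int \<Rightarrow> complex" where
  "additive_char q n = e_mod q (of_int n)"

lemma additive_char_eq_cis: "additive_char q n = cis (2 * pi * of_int n / of_int q)"
  by (simp add: additive_char_def e_mod_def cis_conv_exp mult_ac)

lemma additive_char_0 [simp]: "additive_char q 0 = 1"
  by (simp add: additive_char_eq_cis)

lemma additive_char_add: "additive_char q (m + n) = additive_char q m * additive_char q n"
  by (simp add: additive_char_eq_cis distrib_left add_divide_distrib cis_mult)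

lemma cnj_additive_char: "cnj (additive_char q n) = additive_char q (- n)"
  by (simp add: additive_char_eq_cis cis_cnj)

lemma additive_char_eq_1_iff:
  assumes "q \<noteq> 0"
  shows "additive_char q n = 1 \<longleftrightarrow> q dvd n"
proof
  assume "additive_char q n = 1"
  then have "cos (2 * pi * of_int n / of_int q) = 1"
    unfolding additive_char_eq_cis by (metis cis.simps(1) one_complex.simps(1))
  then obtain k :: int where "2 * pi * of_int n / of_int q = of_int k * 2 * pi"
    unfolding cos_one_2pi_int by blast
  then have "of_int n = (of_int (q * k) :: real)"
    using assms by (simp add: field_simps)
  then show "q dvd n"
    by (metis dvd_triv_left of_int_eq_iff)
next
  assume "q dvd n"
  then show "additive_char q n = 1"
    using e_mod_periodic[of q n 0] assms
    by (simp add: additive_char_def e_mod_def cong_0_iff)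
qed

text \<open>
  If \<open>q\<close> does not divide \<open>n\<close>, then multiplication by \<open>e\<^sub>q (n) \<noteq> 1\<close> only shifts \<open>h\<close> by one,
  which permutes the summands of a full period, so that the sum has to vanish.
\<close>

lemma sum_additive_char:
  assumes "q > 0"
  shows "(\<Sum>h\<in>{0..<q}. additive_char q (h * n)) = (if q dvd n then of_int q else 0)"
proof (cases "q dvd n")
  case True
  then have "additive_char q (h * n) = 1" for h
    using assms by (simp add: additive_char_eq_1_iff)
  then show ?thesis
    using True assms by simp
next
  case False
  let ?T = "\<Sum>h\<in>{0..<q}. additive_char q (h * n)"
  have "additive_char q n * ?T = (\<Sum>h\<in>{0..<q}. additive_char q ((h + 1) * n))"
    by (simp add: sum_distrib_left algebra_simps flip: additive_char_add)
  also have "\<dots> = (\<Sum>h\<in>{1..q}. additive_char q (h * n))"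
    by (rule sum.reindex_bij_witness[of _ "\<lambda>h. h - 1" "\<lambda>h. h + 1"]) auto
  also have "{1..q} = insert q {1..<q}"
    using assms by auto
  also have "(\<Sum>h\<in>insert q {1..<q}. additive_char q (h * n))
      = (\<Sum>h\<in>insert 0 {1..<q}. additive_char q (h * n))"
    using assms additive_char_eq_1_iff[of q "q * n"] by simp
  also have "insert 0 {1..<q} = {0..<q}"
    using assms by auto
  finally have "(additive_char q n - 1) * ?T = 0"
    by (simp add: algebra_simps)
  moreover have "additive_char q n \<noteq> 1"
    using False assms by (simp add: additive_char_eq_1_iff)
  ultimately show ?thesis
    using False by simp
qed

text \<open>
  Parseval's identity on \<open>\<int>/q\<int>\<close> for the indicator function of \<open>S\<close>. Expanding the square
  gives pairs \<open>(s, t)\<close>, of which orthogonality keeps those with \<open>s \<equiv> t\<close>; as the elements of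
  \<open>S\<close> are distinct modulo \<open>q\<close>, these are the diagonal pairs.
\<close>

lemma sum_norm_square_exponential_sum:
  assumes "q > 0" and "finite S" and inj: "inj_on (\<lambda>s. s mod q) S"
  shows "(\<Sum>h\<in>{0..<q}. (norm (\<Sum>s\<in>S. additive_char q (h * s)))\<^sup>2) = of_int q * real (card S)"
proof -
  have expand: "complex_of_real ((norm (\<Sum>s\<in>S. additive_char q (h * s)))\<^sup>2)
      = (\<Sum>s\<in>S. \<Sum>t\<in>S. additive_char q (h * (s - t)))" for h
    unfolding complex_norm_square
    by (simp add: cnj_additive_char sum_product right_diff_distrib flip: additive_char_add)
  have "complex_of_real (\<Sum>h\<in>{0..<q}. (norm (\<Sum>s\<in>S. additive_char q (h * s)))\<^sup>2)
      = (\<Sum>h\<in>{0..<q}. \<Sum>s\<in>S. \<Sum>t\<in>S. additive_char q (h * (s - t)))"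
    unfolding of_real_sum expand ..
  also have "\<dots> = (\<Sum>s\<in>S. \<Sum>t\<in>S. \<Sum>h\<in>{0..<q}. additive_char q (h * (s - t)))"
    by (subst sum.swap, rule sum.cong[OF refl], rule sum.swap)
  also have "\<dots> = (\<Sum>s\<in>S. \<Sum>t\<in>S. if s = t then of_int q else 0)"
  proof (intro sum.cong refl)
    fix s t assume "s \<in> S" "t \<in> S"
    then have "q dvd s - t \<longleftrightarrow> s = t"
      using inj by (auto simp: inj_on_def mod_eq_dvd_iff)
    then show "(\<Sum>h\<in>{0..<q}. additive_char q (h * (s - t))) = (if s = t then of_int q else 0)"
      by (simp add: sum_additive_char[OF \<open>q > 0\<close>])
  qed
  also have "\<dots> = complex_of_real (of_int q * real (card S))"
    using \<open>finite S\<close> by simp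
  finally show ?thesis
    unfolding of_real_eq_iff .
qed

text \<open>
  Fourier expansion of the counting function: each triple contributes the average of
  \<open>e\<^sub>q (h (s + t - b(r)))\<close> over \<open>h\<close>, and for fixed \<open>h\<close> the sum over triples factors.
\<close>

lemma card_solutions_eq_exponential_sum:
  fixes b :: "'a \<Rightarrow> int"
  assumes "q > 0" and "finite R" and "finite S"
  shows "of_int q * of_nat (card {(r, s, t). r \<in> R \<and> s \<in> S \<and> t \<in> S \<and> [s + t = b r] (mod q)})
       = (\<Sum>h\<in>{0..<q}. (\<Sum>s\<in>S. additive_char q (h * s))\<^sup>2 * (\<Sum>r\<in>R. additive_char q (- (h * b r))))"
proof -
  let ?P = "\<lambda>r s t. [s + t = b r] (mod q)"
  have set_eq: "{(r, s, t). r \<in> R \<and> s \<in> S \<and> t \<in> S \<and> ?P r s t}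
      = {x \<in> R \<times> S \<times> S. case x of (r, s, t) \<Rightarrow> ?P r s t}"
    by auto
  have "of_int q * (of_nat (card {(r, s, t). r \<in> R \<and> s \<in> S \<and> t \<in> S \<and> ?P r s t}) :: complex)
      = of_int q * (\<Sum>(r, s, t)\<in>R \<times> S \<times> S. if ?P r s t then 1 else 0)"
    unfolding set_eq using assms by (simp add: sum.If_cases case_prod_unfold Int_def)
  also have "\<dots> = (\<Sum>(r, s, t)\<in>R \<times> S \<times> S. \<Sum>h\<in>{0..<q}. additive_char q (h * (s + t - b r)))"
    by (auto simp: sum_distrib_left sum_additive_char[OF \<open>q > 0\<close>] cong_iff_dvd_diff
        intro!: sum.cong)
  also have "\<dots> = (\<Sum>h\<in>{0..<q}. \<Sum>(r, s, t)\<in>R \<times> S \<times> S. additive_char q (h * (s + t - b r)))"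
    by (simp add: case_prod_unfold sum.swap[of _ "{0..<q}"])
  also have "\<dots> = (\<Sum>h\<in>{0..<q}. (\<Sum>s\<in>S. additive_char q (h * s))\<^sup>2 * (\<Sum>r\<in>R. additive_char q (- (h * b r))))"
  proof (rule sum.cong[OF refl])
    fix h
    have "additive_char q (h * (s + t - b r))
        = additive_char q (- (h * b r)) * (additive_char q (h * s) * additive_char q (h * t))" for r s t
      by (simp add: algebra_simps flip: additive_char_add)
    then have "(\<Sum>(r, s, t)\<in>R \<times> S \<times> S. additive_char q (h * (s + t - b r)))
        = (\<Sum>r\<in>R. additive_char q (- (h * b r))) * (\<Sum>s\<in>S. additive_char q (h * s))\<^sup>2"
      by (simp add: power2_eq_square sum_product sum.cartesian_product case_prod_unfold)
    then show "(\<Sum>(r, s, t)\<in>R \<times> S \<times> S. additive_char q (h * (s + t - b r)))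
        = (\<Sum>s\<in>S. additive_char q (h * s))\<^sup>2 * (\<Sum>r\<in>R. additive_char q (- (h * b r)))"
      by (simp only: mult.commute)
  qed
  finally show ?thesis .
qed

theorem theorem5:
  fixes q a :: int and R S :: "int set"
  assumes "prime q"
    and "gcd a q = 1"
    and "finite R"
    and "\<And>r. r \<in> R \<Longrightarrow> r > 0 \<and> gcd r q = 1"
    and "\<And>s. s \<in> S \<Longrightarrow> 1 \<le> s \<and> s < q"
  shows "\<bar>real (card {(r, s1, s2). r \<in> R \<and> s1 \<in> S \<and> s2 \<in> S \<and> [r * (s1 + s2) = a] (mod q)})
            - 1 / real_of_int q * real (card R) * (real (card S))\<^sup>2\<bar>
         \<le> real (card S) *
             Max ((\<lambda>h. norm (\<Sum>r\<in>R. e_mod q (of_int (h * modular_inverse q r)))) ` {h. \<not> q dvd h})"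
proof -
  have q: "q > 0"
    using \<open>prime q\<close> by (rule prime_gt_0_int)
  have S_sub: "S \<subseteq> {0..<q}"
    using assms(5) by force
  then have fin_S: "finite S"
    using finite_subset by blast
  have "s mod q = s" if "s \<in> S" for s
    using S_sub that by auto
  then have inj: "inj_on (\<lambda>s. s mod q) S"
    by (simp add: inj_on_def)
  define F where "F h = (\<Sum>s\<in>S. additive_char q (h * s))" for h
  define T where "T h = (\<Sum>r\<in>R. additive_char q (h * modular_inverse q r))" for h
  define M where "M = Max ((\<lambda>h. norm (T h)) ` {h. \<not> q dvd h})"
  define N where "N = card {(r, s1, s2). r \<in> R \<and> s1 \<in> S \<and> s2 \<in> S \<and> [r * (s1 + s2) = a] (mod q)}"
  have T_le_M: "norm (T h) \<le> M" if "\<not> q dvd h" for h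
    unfolding M_def T_def additive_char_def
    using that by (intro Max_ge finite_norm_inverse_sums q) auto
  have solve: "[r * x = a] (mod q) \<longleftrightarrow> [x = a * modular_inverse q r] (mod q)" if "r \<in> R" for r x
  proof -
    have cop: "coprime r q"
      using assms(4)[OF that] by (simp add: coprime_iff_gcd_eq_1)
    have "[r * (a * modular_inverse q r) = a * 1] (mod q)"
      using cong_scalar_left[OF cong_modular_inverse1[OF cop], of a] by (simp add: mult_ac)
    then have "[r * x = a] (mod q) \<longleftrightarrow> [r * x = r * (a * modular_inverse q r)] (mod q)"
      by (metis cong_sym cong_trans mult.right_neutral)
    also have "\<dots> \<longleftrightarrow> [x = a * modular_inverse q r] (mod q)"
      by (rule cong_mult_lcancel[OF cop])
    finally show ?thesis .
  qed
  have "N = card {(r, s, t). r \<in> R \<and> s \<in> S \<and> t \<in> S \<and> [s + t = a * modular_inverse q r] (mod q)}"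
    unfolding N_def by (rule arg_cong[where f = card]) (auto simp: solve)
  then have "of_int q * of_nat N = (\<Sum>h\<in>{0..<q}. (F h)\<^sup>2 * T (- (h * a)))"
    using card_solutions_eq_exponential_sum[OF q \<open>finite R\<close> fin_S, of "\<lambda>r. a * modular_inverse q r"]
    by (simp add: F_def T_def mult.assoc)
  also have "{0..<q} = insert 0 {1..<q}"
    using q by auto
  also have "(\<Sum>h\<in>insert 0 {1..<q}. (F h)\<^sup>2 * T (- (h * a)))
      = (of_nat (card S))\<^sup>2 * of_nat (card R) + (\<Sum>h\<in>{1..<q}. (F h)\<^sup>2 * T (- (h * a)))"
    by (simp add: F_def T_def)
  finally have "complex_of_real (of_int q * real N - real (card R) * (real (card S))\<^sup>2)
      = (\<Sum>h\<in>{1..<q}. (F h)\<^sup>2 * T (- (h * a)))"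
    by simp
  then have "\<bar>of_int q * real N - real (card R) * (real (card S))\<^sup>2\<bar>
      = norm (\<Sum>h\<in>{1..<q}. (F h)\<^sup>2 * T (- (h * a)))"
    by (metis norm_of_real real_norm_def)
  also have "\<dots> \<le> (\<Sum>h\<in>{1..<q}. (norm (F h))\<^sup>2 * M)"
  proof (rule sum_norm_le)
    fix h assume h: "h \<in> {1..<q}"
    then have "\<not> q dvd h"
      by (auto dest: zdvd_imp_le)
    moreover have "coprime q a"
      using assms(2) by (simp add: coprime_iff_gcd_eq_1 gcd.commute)
    ultimately have "\<not> q dvd - (h * a)"
      by (simp add: coprime_dvd_mult_left_iff)
    then show "norm ((F h)\<^sup>2 * T (- (h * a))) \<le> (norm (F h))\<^sup>2 * M"
      by (simp add: norm_mult norm_power mult_left_mono T_le_M)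
  qed
  \<comment> \<open>The term \<open>h = 0\<close> is put back to complete the period for Parseval's identity.\<close>
  also have "\<dots> \<le> (\<Sum>h\<in>{0..<q}. (norm (F h))\<^sup>2 * M)"
  proof (rule sum_mono2)
    have "\<not> q dvd 1"
      using \<open>prime q\<close> not_prime_unit by blast
    then have "M \<ge> 0"
      using T_le_M norm_ge_zero order_trans by blast
    then show "0 \<le> (norm (F h))\<^sup>2 * M" for h
      by simp
  qed auto
  also have "\<dots> = of_int q * (real (card S) * M)"
    using sum_norm_square_exponential_sum[OF q fin_S inj]
    by (simp add: F_def flip: sum_distrib_right)
  finally have "\<bar>of_int q * real N - real (card R) * (real (card S))\<^sup>2\<bar> \<le> of_int q * (real (card S) * M)" .
  moreover have "of_int q * real N - real (card R) * (real (card S))\<^sup>2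
      = of_int q * (real N - 1 / of_int q * real (card R) * (real (card S))\<^sup>2)"
    using q by (simp add: field_simps)
  ultimately have "\<bar>real N - 1 / of_int q * real (card R) * (real (card S))\<^sup>2\<bar> \<le> real (card S) * M"
    using q by (simp add: abs_mult)
  then show ?thesis
    unfolding N_def M_def T_def additive_char_def .
qed

end
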